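(* Let $M>0$ and let $p(\rho)=k\rho^{4/3}$, where $k>0$ is a constant. Suppose $L\in C^1[0,M]$ satisfies $L(0)=0$, $L(m)\ge0$ for $0\le m\le M$, and $L(m_0)>0$ for some $m_0\in(0,M)$. Suppose there exist an open bounded set $G\subset\mathbb R^3$ with Lipschitz boundary $\partial G$ and a function $\hat\rho\in W_M$ with $\hat\rho\in C^1(G)\cap C(\mathbb R^3)$ which is a steady state solution of the Euler–Poisson equations in $G$ with velocity field $\hat{\mathbf v}=\Big(-\frac{x_2\sqrt{L(m_{\hat\rho}(r))}}{r^2},\frac{x_1\sqrt{L(m_{\hat\rho}(r))}}{r^2},0\Big)$, i.e. $$\begin{cases}\nabla_xp(\hat\rho)=\hat\rho\,\nabla_x(B\hat\rho)+\hat\rho\,L(m_{\hat\rho}(r(x)))\,r(x)^{-3}\mathbf e_r,& x\in G,\\ \hat\rho=0,& x\in\mathbb R^3\setminus G.\end{cases}$$ Then $\inf_{\rho\in W_M}F(\rho)<0$.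
   Context: Here $\int=\int_{\mathbb R^3}$; for $x\in\mathbb R^3$, $r=r(x)=\sqrt{x_1^2+x_2^2}$ and $\mathbf e_r=(x_1/r,x_2/r,0)$. A function on $\mathbb R^3$ is axisymmetric if it depends only on $(r(x),x_3)$. $Bf(x)=\int\frac{f(y)}{|x-y|}dy$; $m_\rho(r)=\int_{\{r(x)<r\}}\rho(x)\,dx$; $A(\rho)=\rho\int_0^\rho\frac{p(s)}{s^2}ds$. For $M>0$, $$W_M=\Big\{\rho:\mathbb R^3\to\mathbb R:\ \rho\text{ axisymmetric},\ \rho\ge0\text{ a.e.},\ \int\rho\,dx=M,\ \int\Big(A(\rho(x))+\frac{\rho(x)L(m_\rho(r(x)))}{r(x)^2}+\rho(x)B\rho(x)\Big)dx<+\infty\Big\},$$ $$F(\rho)=\int\Big[A(\rho(x))+\frac12\frac{\rho(x)L(m_\rho(r(x)))}{r(x)^2}-\frac12\rho(x)B\rho(x)\Big]dx,\qquad\rho\in W_M.$$ The Euler–Poisson equations are $\rho_t+\nabla\cdot(\rho\mathbf v)=0$, $(\rho\mathbf v)_t+\nabla\cdot(\rho\mathbf v\otimes\mathbf v)+\nabla p(\rho)=-\rho\nabla\Phi$, $\Phi=-B\rho$. *)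

theory Defs
  imports "HOL-Analysis.Analysis"
begin

definition axis_dist :: "real^3 \<Rightarrow> real" where
  "axis_dist x = sqrt ((x$1)\<^sup>2 + (x$2)\<^sup>2)"

definition radial_unit :: "real^3 \<Rightarrow> real^3" where
  "radial_unit x = vector [x$1 / axis_dist x, x$2 / axis_dist x, 0]"

definition axisymmetric :: "(real^3 \<Rightarrow> 'a) \<Rightarrow> bool" where
  "axisymmetric f \<longleftrightarrow>
     (\<forall>x y. axis_dist x = axis_dist y \<and> x$3 = y$3 \<longrightarrow> f x = f y)"

(* Bochner integral: the value is 0 at points x where the integral diverges. For integrable f
   these points form a null set. *)
definition newton_potential :: "(real^3 \<Rightarrow> real) \<Rightarrow> real^3 \<Rightarrow> real" where
  "newton_potential f x = (LINT y|lebesgue. f y / norm (x - y))"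

definition cylinder_mass :: "(real^3 \<Rightarrow> real) \<Rightarrow> real \<Rightarrow> real" where
  "cylinder_mass \<rho> s = (LINT x:{x. axis_dist x < s}|lebesgue. \<rho> x)"

definition internal_energy :: "(real \<Rightarrow> real) \<Rightarrow> real \<Rightarrow> real" where
  "internal_energy p t = t * (LINT s:{0..t}|lebesgue. p s / s\<^sup>2)"

(* All summands of the last integrand are nonnegative almost everywhere when L is nonnegative
   on [0,M], so integrability says exactly that the integral is finite. *)
definition admissible ::
  "(real \<Rightarrow> real) \<Rightarrow> (real \<Rightarrow> real) \<Rightarrow> real \<Rightarrow> (real^3 \<Rightarrow> real) set" where
  "admissible p L M = {\<rho>. axisymmetric \<rho> \<and> (AE x in lebesgue. 0 \<le> \<rho> x) \<and>
     integrable lebesgue \<rho> \<and> (LINT x|lebesgue. \<rho> x) = M \<and>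
     integrable lebesgue (\<lambda>x. internal_energy p (\<rho> x)
       + \<rho> x * L (cylinder_mass \<rho> (axis_dist x)) / (axis_dist x)\<^sup>2
       + \<rho> x * newton_potential \<rho> x)}"

definition energy :: "(real \<Rightarrow> real) \<Rightarrow> (real \<Rightarrow> real) \<Rightarrow> (real^3 \<Rightarrow> real) \<Rightarrow> real" where
  "energy p L \<rho> = (LINT x|lebesgue. internal_energy p (\<rho> x)
     + 1/2 * (\<rho> x * L (cylinder_mass \<rho> (axis_dist x)) / (axis_dist x)\<^sup>2)
     - 1/2 * (\<rho> x * newton_potential \<rho> x))"

(* C^1 on a closed interval: one-sided derivatives at the end points. *)
definition C1_on_interval :: "real \<Rightarrow> real \<Rightarrow> (real \<Rightarrow> real) \<Rightarrow> bool" where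
  "C1_on_interval a b f \<longleftrightarrow> (\<exists>f'. continuous_on {a..b} f' \<and>
     (\<forall>t\<in>{a..b}. (f has_real_derivative f' t) (at t within {a..b})))"

definition C1_on_open :: "'a::real_inner set \<Rightarrow> ('a \<Rightarrow> real) \<Rightarrow> bool" where
  "C1_on_open G f \<longleftrightarrow> (\<exists>g. continuous_on G g \<and> (\<forall>x\<in>G. GDERIV f x :> g x))"

(* Near each boundary point, after an orthogonal change of coordinates T, the set is the region
   strictly above the graph of a Lipschitz function of two variables. *)
definition lipschitz_boundary :: "(real^3) set \<Rightarrow> bool" where
  "lipschitz_boundary G \<longleftrightarrow> (\<forall>z\<in>frontier G. \<exists>T \<gamma> C \<delta>.
     orthogonal_transformation (T :: real^3 \<Rightarrow> real^3) \<and>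
     C-lipschitz_on UNIV (\<gamma> :: real \<times> real \<Rightarrow> real) \<and> 0 < (\<delta>::real) \<and>
     G \<inter> ball z \<delta> = {x \<in> ball z \<delta>. \<gamma> (T x $ 1, T x $ 2) < T x $ 3})"

(* The momentum equation of the Euler-Poisson system for the stationary rotating flow with
   velocity (-x2 * sqrt l / r^2, x1 * sqrt l / r^2, 0), where l = L (cylinder_mass rho r): the
   convective term is -rho * l * r^(-3) * radial_unit. The mass equation is automatic for this
   axisymmetric flow. The direction radial_unit is undefined on the axis r = 0, so the equation
   is imposed at the other points of G. The vector g is the gradient of the potential. *)
definition steady_rotating_solution ::
  "(real \<Rightarrow> real) \<Rightarrow> (real \<Rightarrow> real) \<Rightarrow> (real^3) set \<Rightarrow> (real^3 \<Rightarrow> real) \<Rightarrow> bool" where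
  "steady_rotating_solution p L G \<rho> \<longleftrightarrow>
     (\<forall>x\<in>G. axis_dist x \<noteq> 0 \<longrightarrow> (\<exists>g.
        GDERIV (newton_potential \<rho>) x :> g \<and>
        GDERIV (\<lambda>y. p (\<rho> y)) x :>
          \<rho> x *\<^sub>R g
          + (\<rho> x * L (cylinder_mass \<rho> (axis_dist x)) / axis_dist x ^ 3) *\<^sub>R radial_unit x)) \<and>
     (\<forall>x. x \<notin> G \<longrightarrow> \<rho> x = 0)"

end

theory Submission
  imports Defs
begin

text \<open>
  The virial identity for the steady state makes its own energy negative. Pairing the momentum
  equation with the position vector x and writing P = p(rho), J = rho L(m) / r^2 and U = B rho gives
  int x . grad P = int rho x . grad U + int J. Here int x . grad P = -3 int P and
  int rho x . grad U = -1/2 int rho U. Since A(rho) = 3 p(rho) for the exponent 4/3, the energy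
  collapses to -1/2 int J, which is negative because m takes every value in [0, M].

  Both identities come from differentiating a dilation at t = 1 under the integral sign, which
  replaces the divergence theorem and the differentiation of the singular Newton kernel:
  int P(t x) dx = t^(-3) int P, and the function D(t) = int rho(x) U(t x) dx satisfies
  D(t) = D(1/t) / t, so that D'(1) = -D(1) - D'(1).
\<close>

section \<open>Differentiation under the integral sign\<close>

text \<open>Dominated convergence applies to the difference quotients at \<open>a\<close>, which are
  bounded by \<open>b\<close> and converge to \<open>d\<close> almost everywhere. The domination is
  a Lipschitz bound relative to \<open>a\<close>, so the integrand has to be differentiable only at
  \<open>a\<close> itself. This fits dilations, where derivatives along rays are taken at t = 1
  only.\<close>

lemma has_real_derivative_integral:
  fixes F :: "real \<Rightarrow> 'a \<Rightarrow> real"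
  assumes e: "e > 0"
    and int: "\<And>t. t \<in> ball a e \<Longrightarrow> integrable M (F t)"
    and deriv: "AE x in M. ((\<lambda>t. F t x) has_real_derivative d x) (at a)"
    and lip: "\<And>t x. t \<in> ball a e \<Longrightarrow> \<bar>F t x - F a x\<bar> \<le> b x * \<bar>t - a\<bar>"
    and b: "integrable M b" and d: "d \<in> borel_measurable M"
  shows "integrable M d"
    and "((\<lambda>t. \<integral>x. F t x \<partial>M) has_real_derivative (\<integral>x. d x \<partial>M)) (at a)"
proof -
  let ?Q = "\<lambda>t x. (F t x - F a x) / (t - a)"
  have Fa: "integrable M (F a)" using int e by simp
  have key: "integrable M d \<and> (\<lambda>i. \<integral>x. ?Q (X i) x \<partial>M) \<longlonglongrightarrow> (\<integral>x. d x \<partial>M)"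
    if X: "\<And>i. X i \<in> ball a e - {a}" "X \<longlonglongrightarrow> a" for X :: "nat \<Rightarrow> real"
  proof -
    have meas: "?Q (X i) \<in> borel_measurable M" for i
      using int[of "X i"] X(1)[of i] Fa
      by (intro borel_measurable_divide borel_measurable_diff borel_measurable_integrable) auto
    have lim: "AE x in M. (\<lambda>i. ?Q (X i) x) \<longlonglongrightarrow> d x"
      using deriv
    proof eventually_elim
      case (elim x)
      then have "((\<lambda>t. ?Q t x) \<longlongrightarrow> d x) (at a)"
        by (simp add: has_field_derivative_iff)
      then show ?case
        using X unfolding tendsto_at_iff_sequentially comp_def by blast
    qed
    have bd: "AE x in M. norm (?Q (X i) x) \<le> b x" for i
    proof (rule AE_I2)
      fix x
      show "norm (?Q (X i) x) \<le> b x"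
        using lip[of "X i" x] X(1)[of i] by (auto simp: divide_le_eq abs_divide)
    qed
    show ?thesis
      using integrable_dominated_convergence[OF d meas b lim bd]
        integral_dominated_convergence[OF d meas b lim bd] by auto
  qed
  \<comment> \<open>One concrete sequence in the punctured ball, used to extract integrability of
    \<open>d\<close> from \<open>key\<close>. The denominators start at 2, which keeps the distance
    to \<open>a\<close> strictly below \<open>e\<close>.\<close>
  define Y where "Y = (\<lambda>i::nat. a + e * inverse (real (Suc (Suc i))))"
  have "Y \<longlonglongrightarrow> a + e * 0"
    unfolding Y_def
    by (rule tendsto_add[OF tendsto_const tendsto_mult[OF tendsto_const LIMSEQ_Suc[OF LIMSEQ_inverse_real_of_nat]]])
  moreover have "Y i \<in> ball a e - {a}" for i
    using e by (auto simp: Y_def dist_real_def field_simps intro!: add_pos_nonneg)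
  ultimately show d': "integrable M d"
    using key[of Y] by simp
  have "((\<lambda>t. ((\<integral>x. F t x \<partial>M) - (\<integral>x. F a x \<partial>M)) / (t - a)) \<longlongrightarrow> (\<integral>x. d x \<partial>M)) (at a within ball a e)"
    unfolding tendsto_at_iff_sequentially comp_def
  proof (intro allI impI)
    fix X :: "nat \<Rightarrow> real"
    assume X: "\<forall>i. X i \<in> ball a e - {a}" "X \<longlonglongrightarrow> a"
    have "(\<integral>x. ?Q (X i) x \<partial>M) = ((\<integral>x. F (X i) x \<partial>M) - (\<integral>x. F a x \<partial>M)) / (X i - a)" for i
      using X(1) int[of "X i"] Fa by (simp add: Bochner_Integration.integral_diff)
    then show "(\<lambda>i. ((\<integral>x. F (X i) x \<partial>M) - (\<integral>x. F a x \<partial>M)) / (X i - a)) \<longlonglongrightarrow> (\<integral>x. d x \<partial>M)"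
      using key[of X] X by simp
  qed
  moreover have "at a within ball a e = at a"
    using e by (intro at_within_open) auto
  ultimately show "((\<lambda>t. \<integral>x. F t x \<partial>M) has_real_derivative (\<integral>x. d x \<partial>M)) (at a)"
    by (simp add: has_field_derivative_iff)
qed

section \<open>Inverse square kernels and Lipschitz continuity of the Newton potential\<close>

text \<open>A singularity of order 2 is integrable once the dimension exceeds 2. Order 2 is the size
  of the gradient of the Newton kernel in dimension 3.\<close>

lemma nn_integral_inverse_square_ball:
  assumes "3 \<le> DIM('a::euclidean_space)"
  shows "(\<integral>\<^sup>+ z. ennreal (indicator (ball 0 1) z / (norm (z::'a))\<^sup>2) \<partial>lborel) < \<infinity>"
proof -
  let ?V = "unit_ball_vol (real DIM('a))"
  let ?f = "\<lambda>n z::'a. ennreal (4 ^ Suc n) * indicator (cball 0 (1/2^n)) z"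
  have [measurable]: "cball (0::'a) r \<in> sets borel" for r by (intro borel_closed) auto
  \<comment> \<open>Dyadic shells: on 2^(-n-1) < |z| the integrand is at most 4^(n+1), while the ball has volume O(8^(-n)).\<close>
  have pw: "ennreal (indicator (ball 0 1) z / (norm z)\<^sup>2) \<le> (\<Sum>n. ?f n z)" for z :: 'a
  proof (cases "z = 0 \<or> z \<notin> ball 0 1")
    case True
    then show ?thesis by auto
  next
    case False
    then have z: "0 < norm z" "norm z < 1" by auto
    obtain n0 where n0: "(1/2) ^ n0 < norm z"
      using real_arch_pow_inv[OF z(1), of "1/2"] by auto
    \<comment> \<open>The least such \<open>n\<close> is positive because |z| < 1, and its
      predecessor m places z in the shell 2^(-m-1) < |z| \<le> 2^(-m).\<close>
    define n where "n = (LEAST n. (1/2) ^ n < norm z)"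
    have n1: "(1/2) ^ n < norm z"
      unfolding n_def by (rule LeastI[of _ n0]) (rule n0)
    have "n \<noteq> 0" using n1 z by (cases n) auto
    then obtain m where m: "n = Suc m" by (cases n) auto
    have n2: "norm z \<le> (1/2) ^ m"
      using not_less_Least[of m "\<lambda>n. (1/2) ^ n < norm z"] m by (simp add: n_def)
    have "((1/2) ^ Suc m)\<^sup>2 \<le> (norm z)\<^sup>2"
      using n1 m by (intro power_mono) auto
    moreover have "((1/2) ^ Suc m)\<^sup>2 = 1 / (4::real) ^ Suc m"
      by (simp add: power_divide power2_eq_square flip: power_mult_distrib)
    ultimately have "1 / (norm z)\<^sup>2 \<le> 4 ^ Suc m"
      using z by (simp add: field_simps)
    then have "ennreal (indicator (ball 0 1) z / (norm z)\<^sup>2) \<le> ?f m z"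
      using z n2 by (auto simp: indicator_def power_divide intro!: ennreal_leI)
    also have "\<dots> \<le> (\<Sum>n. ?f n z)"
      using sum_le_suminf[of "\<lambda>n. ?f n z" "{m}"] by (simp del: sum_mult_indicator)
    finally show ?thesis .
  qed
  have "(\<integral>\<^sup>+ z. ennreal (indicator (ball 0 1) z / (norm (z::'a))\<^sup>2) \<partial>lborel)
      \<le> (\<integral>\<^sup>+ z. (\<Sum>n. ?f n z) \<partial>lborel)"
    by (intro nn_integral_mono pw)
  also have "\<dots> = (\<Sum>n. \<integral>\<^sup>+ z. ?f n z \<partial>lborel)"
    by (intro nn_integral_suminf) measurable
  also have "\<dots> \<le> (\<Sum>n. ennreal (4 * ?V * (1/2) ^ n))"
  proof (intro suminf_le)
    fix n
    have "(\<integral>\<^sup>+ z. ?f n z \<partial>lborel) = ennreal (4 ^ Suc n) * emeasure lborel (cball (0::'a) (1/2^n))"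
      by (subst nn_integral_cmult_indicator) auto
    also have "\<dots> = ennreal (4 ^ Suc n * (?V * (1/2^n) ^ DIM('a)))"
      by (simp add: emeasure_cball ennreal_mult')
    \<comment> \<open>The radius is at most 1, so raising the power from 3 to the dimension only
      decreases the volume bound; the series is then geometric with ratio 4/8.\<close>
    also have "\<dots> \<le> ennreal (4 ^ Suc n * (?V * (1/2^n) ^ 3))"
      using assms by (intro ennreal_leI mult_left_mono power_decreasing) auto
    also have "4 ^ Suc n * (?V * (1/2^n) ^ 3) = 4 * ?V * (4 ^ n / (2 ^ n) ^ 3)"
      by (simp add: power_divide)
    also have "4 ^ n / (2 ^ n) ^ 3 = (1/2::real) ^ n"
      by (simp add: power_divide power3_eq_cube field_simps flip: power_mult_distrib)
    finally show "(\<integral>\<^sup>+ z. ?f n z \<partial>lborel) \<le> ennreal (4 * ?V * (1/2) ^ n)" .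
  qed auto
  also have "\<dots> < \<infinity>"
    by (subst suminf_ennreal2) (auto intro!: summable_mult summable_geometric)
  finally show ?thesis .
qed

lemma integrable_const_ball:
  "integrable lborel (\<lambda>x. c * indicator (ball (a::'a::euclidean_space) r) x :: real)"
  using emeasure_lborel_ball_finite[of a r]
  by (intro integrable_mult_right integrable_real_indicator) (auto simp: less_top)

text \<open>The kernel is at most its part on |x - y| < 1 plus the indicator of the ball. The first
  part has an integral independent of x by translation invariance, which makes the bound
  \<open>C\<close> uniform in x.\<close>

lemma integrable_inverse_square_ball:
  assumes "3 \<le> DIM('a::euclidean_space)"
  obtains C where "0 \<le> C"
    "\<And>x::'a. integrable lborel (\<lambda>y. indicator (ball 0 R) y / (norm (x - y))\<^sup>2)"
    "\<And>x::'a. (\<integral>y. indicator (ball 0 R) y / (norm (x - y))\<^sup>2 \<partial>lborel) \<le> C"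
proof -
  have [measurable]: "ball (0::'a) r \<in> sets borel" for r by (intro borel_open) auto
  let ?h = "\<lambda>z::'a. ennreal (indicator (ball 0 1) z / (norm z)\<^sup>2)"
  define A where "A = (\<integral>\<^sup>+ z. ?h z \<partial>lborel) + emeasure lborel (ball (0::'a) R)"
  have A: "A < \<infinity>"
    using nn_integral_inverse_square_ball[OF assms] emeasure_lborel_ball_finite[of "0::'a" R]
    by (simp add: A_def)
  have shift: "(\<integral>\<^sup>+ y. ?h (x - y) \<partial>lborel) = (\<integral>\<^sup>+ z. ?h z \<partial>lborel)" for x :: 'a
  proof -
    \<comment> \<open>The reflection y to x - y is the affine map with factor -1, whose Jacobian has
      absolute value 1.\<close>
    have "(\<integral>\<^sup>+ z. ?h z \<partial>lborel) = (\<integral>\<^sup>+ z. ?h z \<partial>distr lborel borel (\<lambda>y. x + (-1) *\<^sub>R y))"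
      by (subst lborel_affine[of "-1" x]) (simp_all add: density_1)
    also have "\<dots> = (\<integral>\<^sup>+ y. ?h (x + (-1) *\<^sub>R y) \<partial>lborel)"
      by (rule nn_integral_distr) measurable
    finally show ?thesis by simp
  qed
  have bound: "(\<integral>\<^sup>+ y. ennreal (indicator (ball 0 R) y / (norm (x - y))\<^sup>2) \<partial>lborel) \<le> A" for x :: 'a
  proof -
    have "ennreal (indicator (ball 0 R) y / (norm (x - y))\<^sup>2)
        \<le> ?h (x - y) + indicator (ball 0 R) y" for y
    proof (cases "norm (x - y) < 1")
      case True
      then show ?thesis by (auto simp: indicator_def)
    next
      case False
      then have "1 \<le> (norm (x - y))\<^sup>2" by simp
      then have "indicator (ball 0 R) y / (norm (x - y))\<^sup>2 \<le> indicator (ball 0 R) y"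
        by (auto simp: indicator_def divide_le_eq_1)
      then have "ennreal (indicator (ball 0 R) y / (norm (x - y))\<^sup>2) \<le> ennreal (indicator (ball 0 R) y)"
        by (rule ennreal_leI)
      then show ?thesis by (simp add: ennreal_indicator add_increasing)
    qed
    then have "(\<integral>\<^sup>+ y. ennreal (indicator (ball 0 R) y / (norm (x - y))\<^sup>2) \<partial>lborel)
        \<le> (\<integral>\<^sup>+ y. ?h (x - y) + indicator (ball 0 R) y \<partial>lborel)"
      by (intro nn_integral_mono) auto
    also have "\<dots> = A"
      by (subst nn_integral_add) (auto simp: shift A_def)
    finally show ?thesis .
  qed
  have int: "integrable lborel (\<lambda>y. indicator (ball 0 R) y / (norm (x - y))\<^sup>2)" for x :: 'a
    using bound[of x] A by (intro integrableI_nonneg) (auto intro: le_less_trans)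
  moreover have "(\<integral>y. indicator (ball 0 R) y / (norm (x - y))\<^sup>2 \<partial>lborel) \<le> enn2real A" for x :: 'a
    using bound[of x] A by (subst integral_eq_nn_integral) (auto intro: enn2real_mono)
  ultimately show thesis
    by (intro that[of "enn2real A"]) auto
qed

lemma newton_potential_lborel:
  assumes "\<rho> \<in> borel_measurable borel"
  shows "newton_potential \<rho> x = (\<integral>y. \<rho> y / norm (x - y) \<partial>lborel)"
  unfolding newton_potential_def using assms by (intro integral_completion) simp

lemma integrable_mult_bounded_support:
  fixes \<rho> g :: "'a::euclidean_space \<Rightarrow> real"
  assumes \<rho>: "\<rho> \<in> borel_measurable borel" "\<And>y. \<bar>\<rho> y\<bar> \<le> K * indicator (ball 0 R) y"
    and g: "continuous_on UNIV g"
  shows "integrable lborel (\<lambda>x. \<rho> x * g x)"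
proof -
  have "compact (g ` cball 0 R)"
    using g by (intro compact_continuous_image) (auto intro: continuous_on_subset)
  then obtain B where B: "\<And>x. x \<in> cball 0 R \<Longrightarrow> \<bar>g x\<bar> \<le> B"
    by (meson bounded_real compact_imp_bounded imageI)
  have [measurable]: "g \<in> borel_measurable borel"
    using g by (rule borel_measurable_continuous_onI)
  note [measurable] = \<rho>(1)
  have fin: "integrable lborel (\<lambda>x. (K * B) * indicator (ball (0::'a) R) x)"
    by (rule integrable_const_ball)
  show ?thesis
  proof (rule Bochner_Integration.integrable_bound[OF fin])
    show "AE x in lborel. norm (\<rho> x * g x) \<le> norm (K * B * indicator (ball (0::'a) R) x)"
    proof (rule AE_I2)
      fix x :: 'a
      show "norm (\<rho> x * g x) \<le> norm (K * B * indicator (ball (0::'a) R) x)"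
      proof (cases "x \<in> ball 0 R")
        case True
        then have "\<bar>\<rho> x\<bar> \<le> K" "\<bar>g x\<bar> \<le> B" using \<rho>(2)[of x] B[of x] by auto
        then have "\<bar>\<rho> x\<bar> * \<bar>g x\<bar> \<le> K * B" by (intro mult_mono) auto
        then have "\<bar>\<rho> x * g x\<bar> \<le> \<bar>K * B\<bar>"
          unfolding abs_mult[of "\<rho> x"] by linarith
        then show ?thesis using True by simp
      next
        case False
        then show ?thesis using \<rho>(2)[of x] by simp
      qed
    qed
  qed auto
qed

text \<open>Since a \<le> 1 + a^2 for a = 1 / |x - y|, the inverse square kernel plus a constant
  dominates on the ball.\<close>

lemma integrable_newton_kernel:
  fixes x :: "real^3"
  assumes \<rho>: "\<rho> \<in> borel_measurable borel" "\<And>y. \<bar>\<rho> y\<bar> \<le> K * indicator (ball 0 R) y"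
  shows "integrable lborel (\<lambda>y. \<rho> y / norm (x - y))"
proof -
  note [measurable] = \<rho>(1)
  obtain C where "integrable lborel (\<lambda>y::real^3. indicator (ball 0 R) y / (norm (x - y))\<^sup>2)"
    using integrable_inverse_square_ball[where 'a = "real^3" and R = R] by auto
  then have int: "integrable lborel (\<lambda>y::real^3. K * (indicator (ball 0 R) y + indicator (ball 0 R) y / (norm (x - y))\<^sup>2))"
    using integrable_const_ball[of 1 "0::real^3" R]
    by (intro integrable_mult_right Bochner_Integration.integrable_add) auto
  show ?thesis
  proof (rule Bochner_Integration.integrable_bound[OF int])
    show "AE y in lborel. norm (\<rho> y / norm (x - y))
        \<le> norm (K * (indicator (ball 0 R) y + indicator (ball 0 R) y / (norm (x - y))\<^sup>2))"
    proof (rule AE_I2)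
      fix y
      define a where "a = 1 / norm (x - y)"
      have "0 \<le> a" by (simp add: a_def)
      then have "a \<le> 1 + a\<^sup>2"
        using sum_squares_bound[of 1 a] by simp
      then have "\<bar>\<rho> y\<bar> * a \<le> (K * indicator (ball 0 R) y) * (1 + a\<^sup>2)"
        using \<rho>(2)[of y] by (intro mult_mono) (auto simp: a_def)
      also have "\<dots> = K * (indicator (ball 0 R) y + indicator (ball 0 R) y / (norm (x - y))\<^sup>2)"
        by (simp add: a_def power_divide algebra_simps)
      finally show "norm (\<rho> y / norm (x - y))
          \<le> norm (K * (indicator (ball 0 R) y + indicator (ball 0 R) y / (norm (x - y))\<^sup>2))"
        using abs_ge_self[of "K * (indicator (ball 0 R) y + indicator (ball 0 R) y / (norm (x - y))\<^sup>2)"]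
        by (simp add: a_def del: abs_ge_self)
    qed
  qed auto
qed

text \<open>The difference of the kernels at x and x' is at most |x - x'| times the sum of the two
  inverse square kernels, whose integrals over the ball are bounded uniformly in the centre. The
  singular kernel itself is never differentiated.\<close>

lemma newton_potential_lipschitz:
  assumes \<rho>: "\<rho> \<in> borel_measurable borel" "\<And>y. \<bar>\<rho> y\<bar> \<le> K * indicator (ball 0 R) y"
    and K: "0 \<le> K"
  obtains C where "C-lipschitz_on UNIV (newton_potential \<rho>)"
proof -
  note [measurable] = \<rho>(1)
  obtain C where C: "0 \<le> C"
    "\<And>x::real^3. integrable lborel (\<lambda>y. indicator (ball 0 R) y / (norm (x - y))\<^sup>2)"
    "\<And>x::real^3. (\<integral>y. indicator (ball 0 R) y / (norm (x - y))\<^sup>2 \<partial>lborel) \<le> C"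
    using integrable_inverse_square_ball[where 'a = "real^3" and R = R] by auto
  \<comment> \<open>This also holds where x = y or x' = y, with the junk value 1 / 0 = 0.\<close>
  have kernel: "\<bar>1 / norm (x - y) - 1 / norm (x' - y)\<bar>
      \<le> norm (x - x') * (1 / (norm (x - y))\<^sup>2 + 1 / (norm (x' - y))\<^sup>2)" for x x' y :: "real^3"
  proof (cases "x = y \<or> x' = y")
    case True
    then show ?thesis
      by (auto simp: norm_minus_commute power2_eq_square)
  next
    case False
    define a b where "a = norm (x - y)" and "b = norm (x' - y)"
    have pos: "a > 0" "b > 0" using False by (auto simp: a_def b_def)
    have "\<bar>b - a\<bar> \<le> norm (x - x')"
      using norm_triangle_ineq3[of "x' - y" "x - y"] by (simp add: a_def b_def norm_minus_commute)
    then have "\<bar>1 / a - 1 / b\<bar> \<le> norm (x - x') * ((1 / a) * (1 / b))"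
      using pos by (simp add: divide_simps abs_if split: if_splits)
    also have "(1 / a) * (1 / b) \<le> (1 / a)\<^sup>2 + (1 / b)\<^sup>2"
    proof -
      have "0 \<le> (1 / a) * (1 / b)" using pos by simp
      then show ?thesis using sum_squares_bound[of "1 / a" "1 / b"] by linarith
    qed
    finally show ?thesis
      by (simp add: a_def b_def power_divide mult_left_mono)
  qed
  have "\<bar>newton_potential \<rho> x - newton_potential \<rho> x'\<bar> \<le> (K * (2 * C)) * norm (x - x')" for x x'
  proof -
    let ?k = "\<lambda>x y. indicator (ball 0 R) y / (norm (x - y :: real^3))\<^sup>2"
    have "\<bar>newton_potential \<rho> x - newton_potential \<rho> x'\<bar>
        = \<bar>\<integral>y. \<rho> y / norm (x - y) - \<rho> y / norm (x' - y) \<partial>lborel\<bar>"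
      by (simp add: newton_potential_lborel[OF \<rho>(1)] integrable_newton_kernel[OF \<rho>])
    also have "\<dots> \<le> (\<integral>y. \<bar>\<rho> y / norm (x - y) - \<rho> y / norm (x' - y)\<bar> \<partial>lborel)"
      by (rule integral_abs_bound)
    also have "\<dots> \<le> (\<integral>y. K * norm (x - x') * (?k x y + ?k x' y) \<partial>lborel)"
    proof (rule integral_mono)
      fix y
      have "\<bar>\<rho> y / norm (x - y) - \<rho> y / norm (x' - y)\<bar> = \<bar>\<rho> y\<bar> * \<bar>1 / norm (x - y) - 1 / norm (x' - y)\<bar>"
        by (simp add: right_diff_distrib flip: abs_mult)
      also have "\<dots> \<le> (K * indicator (ball 0 R) y) * (norm (x - x') * (1 / (norm (x - y))\<^sup>2 + 1 / (norm (x' - y))\<^sup>2))"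
        using \<rho>(2)[of y] by (intro mult_mono kernel) auto
      also have "\<dots> = K * norm (x - x') * (?k x y + ?k x' y)"
        by (simp add: algebra_simps)
      finally show "\<bar>\<rho> y / norm (x - y) - \<rho> y / norm (x' - y)\<bar> \<le> K * norm (x - x') * (?k x y + ?k x' y)" .
    qed (auto intro!: integrable_abs integrable_newton_kernel[OF \<rho>] C(2))
    also have "\<dots> = K * norm (x - x') * ((\<integral>y. ?k x y \<partial>lborel) + (\<integral>y. ?k x' y \<partial>lborel))"
      by (simp add: C(2))
    also have "\<dots> \<le> K * norm (x - x') * (C + C)"
      using K by (intro mult_left_mono add_mono C(3)) auto
    finally show ?thesis by (simp add: algebra_simps)
  qed
  then have "(K * (2 * C))-lipschitz_on UNIV (newton_potential \<rho>)"
    using K C(1) by (intro lipschitz_onI) (auto simp: dist_norm)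
  then show thesis by (rule that)
qed

section \<open>Dilations and the virial identity for the potential\<close>

lemma GDERIV_ray:
  assumes "GDERIV f x :> g"
  shows "((\<lambda>t. f (t *\<^sub>R x)) has_real_derivative x \<bullet> g) (at 1)"
proof -
  have "((\<lambda>t::real. t *\<^sub>R x) has_derivative (\<lambda>t. t *\<^sub>R x)) (at 1)"
    by (auto intro!: derivative_eq_intros)
  moreover have "(f has_derivative (\<lambda>h. h \<bullet> g)) (at (1 *\<^sub>R x))"
    using assms by (simp add: gderiv_def)
  ultimately have "((\<lambda>t. f (t *\<^sub>R x)) has_derivative (\<lambda>t. (t *\<^sub>R x) \<bullet> g)) (at 1)"
    by (rule has_derivative_compose)
  then show ?thesis
    by (simp add: has_field_derivative_def mult_commute_abs)
qed

lemma lborel_integral_scaleR: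
  fixes f :: "'a::euclidean_space \<Rightarrow> real"
  assumes [measurable]: "f \<in> borel_measurable borel" and "0 < c"
  shows "(\<integral>x. f x \<partial>lborel) = c ^ DIM('a) * (\<integral>x. f (c *\<^sub>R x) \<partial>lborel)"
  using assms(2)
  by (subst lborel_affine[of c 0]) (simp_all add: integral_density integral_distr)

text \<open>The kernel satisfies |t x - y| = t |y / t - x|, so exchanging the two integrations moves
  the dilation from one copy of the density to the other with inverted factor.\<close>

lemma newton_potential_scaled_pairing:
  assumes \<rho>: "\<rho> \<in> borel_measurable borel" "\<And>y. \<bar>\<rho> y\<bar> \<le> K * indicator (ball 0 R) y"
    and K: "0 \<le> K" and t: "0 < t"
  shows "(\<integral>x. \<rho> x * newton_potential \<rho> (t *\<^sub>R x) \<partial>lborel)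
    = (\<integral>x. \<rho> x * newton_potential \<rho> ((1 / t) *\<^sub>R x) \<partial>lborel) / t"
proof -
  note [measurable] = \<rho>(1)
  let ?f = "\<lambda>x y. \<rho> x * (\<rho> y / norm (t *\<^sub>R x - y))"
  let ?a = "\<lambda>y. \<bar>\<rho> y\<bar>"
  have a: "?a \<in> borel_measurable borel" "\<And>y. \<bar>?a y\<bar> \<le> K * indicator (ball 0 R) y"
    using \<rho> by auto
  obtain C where C: "C-lipschitz_on UNIV (newton_potential ?a)"
    using newton_potential_lipschitz[OF a K] .
  have "integrable (lborel \<Otimes>\<^sub>M lborel) (case_prod ?f)"
  proof (rule lborel_pair.Fubini_integrable)
    show "case_prod ?f \<in> borel_measurable (lborel \<Otimes>\<^sub>M lborel)"
      by measurable
    \<comment> \<open>Integrating the absolute value of \<open>?f\<close> over y gives |rho x| times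
      the potential of |rho| at t x. Continuity of this potential yields the absolute integrability
      that Fubini requires.\<close>
    have "continuous_on UNIV (\<lambda>x. newton_potential ?a (t *\<^sub>R x))"
      by (intro continuous_on_compose2[OF lipschitz_on_continuous_on[OF C]] continuous_intros) auto
    then have "integrable lborel (\<lambda>x. ?a x * newton_potential ?a (t *\<^sub>R x))"
      by (rule integrable_mult_bounded_support[OF a])
    then show "integrable lborel (\<lambda>x. \<integral>y. norm (case_prod ?f (x, y)) \<partial>lborel)"
      by (simp add: newton_potential_lborel[OF a(1)] abs_mult flip: times_divide_eq_right)
    show "AE x in lborel. integrable lborel (\<lambda>y. case_prod ?f (x, y))"
      using integrable_mult_right[OF integrable_newton_kernel[OF \<rho>]] by simp
  qed
  then have "(\<integral>y. (\<integral>x. ?f x y \<partial>lborel) \<partial>lborel) = (\<integral>x. (\<integral>y. ?f x y \<partial>lborel) \<partial>lborel)"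
    by (rule lborel_pair.Fubini_integral)
  moreover have "(\<integral>x. ?f x y \<partial>lborel) = \<rho> y * newton_potential \<rho> ((1 / t) *\<^sub>R y) / t" for y
  proof -
    have "norm (t *\<^sub>R x - y) = t * norm ((1 / t) *\<^sub>R y - x)" for x
    proof -
      have "t *\<^sub>R x - y = - (t *\<^sub>R ((1 / t) *\<^sub>R y - x))"
        using t by (simp add: algebra_simps)
      then show ?thesis using t by (simp only: norm_minus_cancel norm_scaleR)
    qed
    then have "?f x y = (\<rho> y / t) * (\<rho> x / norm ((1 / t) *\<^sub>R y - x))" for x
      by (simp add: field_simps)
    then have "(\<integral>x. ?f x y \<partial>lborel) = (\<rho> y / t) * (\<integral>x. \<rho> x / norm ((1 / t) *\<^sub>R y - x) \<partial>lborel)"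
      by (simp only: integral_mult_right_zero)
    then show ?thesis by (simp add: newton_potential_lborel[OF \<rho>(1)])
  qed
  moreover have "(\<integral>y. ?f x y \<partial>lborel) = \<rho> x * newton_potential \<rho> (t *\<^sub>R x)" for x
    by (simp only: newton_potential_lborel[OF \<rho>(1)] integral_mult_right_zero)
  ultimately show ?thesis by simp
qed

text \<open>The gradient \<open>g\<close> enters as data, to be supplied by the momentum equation.
  Where rho vanishes, the integrand of \<open>?D\<close> is constantly 0 in t, so its derivative is
  0 whatever \<open>g\<close> is there. Differentiating D(t) = D(1/t) / t at t = 1 then determines
  D'(1).\<close>

lemma newton_potential_virial:
  assumes \<rho>: "\<rho> \<in> borel_measurable borel" "\<And>y. \<bar>\<rho> y\<bar> \<le> K * indicator (ball 0 R) y"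
    and K: "0 \<le> K"
    and g: "AE x in lborel. \<rho> x \<noteq> 0 \<longrightarrow> GDERIV (newton_potential \<rho>) x :> g x"
    and meas: "(\<lambda>x. \<rho> x * (x \<bullet> g x)) \<in> borel_measurable borel"
  shows "integrable lborel (\<lambda>x. \<rho> x * (x \<bullet> g x))"
    and "(\<integral>x. \<rho> x * (x \<bullet> g x) \<partial>lborel) = - (\<integral>x. \<rho> x * newton_potential \<rho> x \<partial>lborel) / 2"
proof -
  obtain C where C: "C-lipschitz_on UNIV (newton_potential \<rho>)"
    using newton_potential_lipschitz[OF \<rho> K] .
  let ?F = "\<lambda>t x. \<rho> x * newton_potential \<rho> (t *\<^sub>R x)"
  let ?D = "\<lambda>t. \<integral>x. ?F t x \<partial>lborel"
  let ?I = "\<integral>x. \<rho> x * (x \<bullet> g x) \<partial>lborel"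
  have int: "integrable lborel (?F t)" for t
    by (intro integrable_mult_bounded_support[OF \<rho>] continuous_intros
        continuous_on_compose2[OF lipschitz_on_continuous_on[OF C]]) auto
  have deriv: "AE x in lborel. ((\<lambda>t. ?F t x) has_real_derivative \<rho> x * (x \<bullet> g x)) (at 1)"
    using g
  proof eventually_elim
    case (elim x)
    then show ?case
      by (cases "\<rho> x = 0") (auto intro!: DERIV_cmult GDERIV_ray)
  qed
  have lip: "\<bar>?F t x - ?F 1 x\<bar> \<le> (C * (\<bar>\<rho> x\<bar> * norm x)) * \<bar>t - 1\<bar>" for t x
  proof -
    have "\<bar>newton_potential \<rho> (t *\<^sub>R x) - newton_potential \<rho> (1 *\<^sub>R x)\<bar> \<le> C * norm ((t - 1) *\<^sub>R x)"
      using lipschitz_onD[OF C, of "t *\<^sub>R x" "1 *\<^sub>R x"]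
      by (simp add: dist_norm scaleR_diff_left)
    then have "\<bar>\<rho> x\<bar> * \<bar>newton_potential \<rho> (t *\<^sub>R x) - newton_potential \<rho> (1 *\<^sub>R x)\<bar> \<le> \<bar>\<rho> x\<bar> * (C * norm ((t - 1) *\<^sub>R x))"
      by (intro mult_left_mono) auto
    then show ?thesis
      by (simp only: right_diff_distrib[symmetric] abs_mult norm_scaleR real_norm_def mult_ac)
  qed
  have b: "integrable lborel (\<lambda>x. C * (\<bar>\<rho> x\<bar> * norm x))"
    using \<rho> by (intro integrable_mult_right integrable_mult_bounded_support[where K = K and R = R]
        continuous_intros) auto
  have meas': "(\<lambda>x. \<rho> x * (x \<bullet> g x)) \<in> borel_measurable lborel"
    using meas by simp
  note D = has_real_derivative_integral[of 1 1 lborel ?F, OF zero_less_one int deriv lip b meas']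
  show "integrable lborel (\<lambda>x. \<rho> x * (x \<bullet> g x))" by (rule D(1))
  have D1: "(?D has_real_derivative ?I) (at 1)" by (rule D(2))
  have "((\<lambda>t. ?D (1 / t) / t) has_real_derivative - ?I - ?D 1) (at 1)"
  proof -
    have "((\<lambda>t. ?D (1 / t)) has_real_derivative ?I * (-1)) (at 1)"
      by (rule DERIV_chain2[of ?D]) (use D1 in \<open>auto intro!: derivative_eq_intros\<close>)
    then show ?thesis
      by (auto intro!: derivative_eq_intros)
  qed
  \<comment> \<open>The scaling identity holds for all t > 0, hence near 1, so the derivative just
    computed is also a derivative of \<open>?D\<close>.\<close>
  moreover have "\<forall>\<^sub>F t in nhds (1::real). ?D (1 / t) / t = ?D t"
  proof -
    have "\<forall>\<^sub>F t in nhds (1::real). t > 0"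
      by (rule eventually_nhds_in_open[of "{0<..}", simplified]) auto
    then show ?thesis
      by eventually_elim (rule newton_potential_scaled_pairing[OF \<rho> K, symmetric])
  qed
  ultimately have "(?D has_real_derivative - ?I - ?D 1) (at 1)"
    by (subst (asm) DERIV_cong_ev[OF refl _ refl]) auto
  then have "?I = - ?I - ?D 1"
    using D1 DERIV_unique by blast
  then show "?I = - (\<integral>x. \<rho> x * newton_potential \<rho> x \<partial>lborel) / 2" by simp
qed

section \<open>The dilation identity for the pressure\<close>

text \<open>This is the divergence theorem for the field f(x) x, obtained by differentiating at t =
  1 that the integral of f(t x) is t^(-n) times the integral of f. The gradient bound makes f
  Lipschitz and supplies the domination.\<close>

lemma integral_radial_derivative:
  fixes f :: "'a::euclidean_space \<Rightarrow> real"
  assumes f: "\<And>x. GDERIV f x :> g x" "\<And>x. norm (g x) \<le> B"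
    and supp: "\<And>x. x \<notin> ball 0 R \<Longrightarrow> f x = 0"
    and g[measurable]: "g \<in> borel_measurable borel"
  shows "(\<integral>x. x \<bullet> g x \<partial>lborel) = - real DIM('a) * (\<integral>x. f x \<partial>lborel)"
proof -
  have cont: "continuous_on UNIV f"
    using f(1) unfolding gderiv_def
    by (intro continuous_at_imp_continuous_on ballI) (blast intro: has_derivative_continuous)
  have [measurable]: "f \<in> borel_measurable borel"
    using cont by (rule borel_measurable_continuous_onI)
  have B: "0 \<le> B" using f(2)[of 0] norm_ge_zero[of "g 0"] by linarith
  have lip0: "norm (f x - f y) \<le> B * norm (x - y)" for x y
  proof (rule differentiable_bound[of UNIV])
    fix x :: 'a
    show "(f has_derivative (\<lambda>h. h \<bullet> g x)) (at x within UNIV)"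
      using f(1)[of x] by (simp add: gderiv_def)
    show "onorm (\<lambda>h. h \<bullet> g x) \<le> B"
    proof (rule onorm_bound[OF B])
      fix h
      have "\<bar>h \<bullet> g x\<bar> \<le> norm h * norm (g x)" by (rule Cauchy_Schwarz_ineq2)
      also have "\<dots> \<le> norm h * B" using f(2) by (intro mult_left_mono) auto
      finally show "norm (h \<bullet> g x) \<le> B * norm h" by (simp add: mult.commute)
    qed
  qed auto
  let ?F = "\<lambda>t x. f (t *\<^sub>R x)"
  \<comment> \<open>For |t - 1| < 1/2 one has t > 1/2, so f(t x) can be nonzero only for |x| < 2
    R.\<close>
  let ?b = "\<lambda>x::'a. (B * (2 * R)) * indicator (ball 0 (2 * R)) x"
  have out: "f (t *\<^sub>R x) = 0" if "t \<in> ball 1 (1/2)" "x \<notin> ball 0 (2 * R)" for t x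
  proof -
    have "t > 1/2" using that(1) by (auto simp: dist_real_def abs_if split: if_splits)
    then have "(1/2) * norm x \<le> norm (t *\<^sub>R x)" using mult_right_mono[of "1/2" t "norm x"] by simp
    then show ?thesis using that(2) by (intro supp) auto
  qed
  have fin: "integrable lborel (\<lambda>x. c * indicator (ball (0::'a) r) x)" for c r :: real
    by (rule integrable_const_ball)
  have lip: "\<bar>?F t x - ?F 1 x\<bar> \<le> ?b x * \<bar>t - 1\<bar>" if t: "t \<in> ball 1 (1/2)" for t x
  proof (cases "x \<in> ball 0 (2 * R)")
    case True
    have "\<bar>?F t x - ?F 1 x\<bar> \<le> B * norm ((t - 1) *\<^sub>R x)"
      using lip0[of "t *\<^sub>R x" "1 *\<^sub>R x"] by (simp add: scaleR_diff_left)
    also have "\<dots> = B * (\<bar>t - 1\<bar> * norm x)" by simp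
    also have "\<dots> \<le> B * (\<bar>t - 1\<bar> * (2 * R))"
      using True B by (intro mult_left_mono) auto
    finally show ?thesis using True by (simp add: algebra_simps)
  next
    case False
    then show ?thesis using out[OF t False] out[of 1 x] by simp
  qed
  have int: "integrable lborel (?F t)" if t: "t \<in> ball 1 (1/2)" for t
  proof -
    have "compact (f ` cball 0 R)"
      using cont by (intro compact_continuous_image) (auto intro: continuous_on_subset)
    then obtain A where A: "\<And>x. x \<in> cball 0 R \<Longrightarrow> \<bar>f x\<bar> \<le> A"
      by (meson bounded_real compact_imp_bounded imageI)
    have A': "\<bar>f x\<bar> \<le> \<bar>A\<bar>" for x
      using A[of x] supp[of x] by (cases "x \<in> ball 0 R") auto
    show ?thesis
    proof (rule Bochner_Integration.integrable_bound[OF fin[of "\<bar>A\<bar>" "2 * R"]])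
      show "AE x in lborel. norm (?F t x) \<le> norm (\<bar>A\<bar> * indicator (ball 0 (2 * R)) x)"
      proof (rule AE_I2)
        fix x :: 'a
        show "norm (?F t x) \<le> norm (\<bar>A\<bar> * indicator (ball 0 (2 * R)) x)"
          using A'[of "t *\<^sub>R x"] out[OF t, of x] by (cases "x \<in> ball 0 (2 * R)") auto
      qed
    qed auto
  qed
  have half: "(0::real) < 1/2" by simp
  have deriv: "AE x in lborel. ((\<lambda>t. ?F t x) has_real_derivative x \<bullet> g x) (at 1)"
    by (intro AE_I2 GDERIV_ray f(1))
  have meas: "(\<lambda>x. x \<bullet> g x) \<in> borel_measurable lborel" by measurable
  note D1 = has_real_derivative_integral(2)[of "1/2" 1 lborel ?F, OF half int deriv lip fin meas]
  have "((\<lambda>t. inverse t ^ DIM('a) * (\<integral>x. f x \<partial>lborel))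
      has_real_derivative - real DIM('a) * (\<integral>x. f x \<partial>lborel)) (at 1)"
    by (auto intro!: derivative_eq_intros)
  moreover have "\<forall>\<^sub>F t in nhds (1::real). (\<integral>x. ?F t x \<partial>lborel) = inverse t ^ DIM('a) * (\<integral>x. f x \<partial>lborel)"
  proof -
    have "\<forall>\<^sub>F t in nhds (1::real). t > 0"
      by (rule eventually_nhds_in_open[of "{0<..}", simplified]) auto
    then show ?thesis
    proof eventually_elim
      case (elim t)
      have "inverse t ^ DIM('a) * t ^ DIM('a) = 1"
        using elim by (simp flip: power_mult_distrib)
      then show ?case
        using lborel_integral_scaleR[of f t] elim by (simp flip: mult.assoc)
    qed
  qed
  ultimately have "((\<lambda>t. \<integral>x. ?F t x \<partial>lborel) has_real_derivative - real DIM('a) * (\<integral>x. f x \<partial>lborel)) (at 1)"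
    by (simp add: DERIV_cong_ev)
  with D1 show ?thesis by (rule DERIV_unique)
qed

text \<open>Squaring removes the kink of the positive part: at 0 the difference quotient is bounded
  by |h|. This makes the truncation of the pressure differentiable where P = \<epsilon>.\<close>

lemma has_real_derivative_max_zero_square:
  "((\<lambda>u::real. (max 0 u)\<^sup>2) has_real_derivative 2 * max 0 u) (at u)"
proof -
  consider "u < 0" | "u = 0" | "0 < u" by linarith
  then show ?thesis
  proof cases
    case 1
    have "((\<lambda>u::real. 0) has_real_derivative 2 * max 0 u) (at u)" using 1 by simp
    then show ?thesis
      by (rule has_field_derivative_transform_within_open[where S = "{..<0}"]) (use 1 in auto)
  next
    case 2
    have "((\<lambda>h::real. (max 0 h)\<^sup>2 / h) \<longlongrightarrow> 0) (at 0)"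
    proof (rule Lim_null_comparison)
      have "norm ((max 0 h)\<^sup>2 / h) \<le> \<bar>h\<bar>" for h :: real
        by (cases "0 < h") (auto simp: power2_eq_square max_def)
      then show "\<forall>\<^sub>F h in at 0. norm ((max 0 h)\<^sup>2 / h) \<le> \<bar>h::real\<bar>" by simp
      show "((\<lambda>h::real. \<bar>h\<bar>) \<longlongrightarrow> 0) (at 0)"
        by (rule tendsto_rabs_zero) (rule tendsto_ident_at)
    qed
    then show ?thesis using 2 by (simp add: has_field_derivative_iff)
  next
    case 3
    have "((\<lambda>u::real. u\<^sup>2) has_real_derivative 2 * max 0 u) (at u)"
      using 3 by (auto intro!: derivative_eq_intros)
    then show ?thesis
      by (rule has_field_derivative_transform_within_open[where S = "{0<..}"]) (use 3 in auto)
  qed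
qed

text \<open>
  P need not be differentiable where it vanishes. The function (P - \<epsilon>)^2 / P, extended by 0 to
  the set P \<le> \<epsilon>, is globally C^1 with compact support; as \<epsilon> tends to 0 it tends to P and its
  derivative with respect to P tends boundedly to 1, so no boundary term ever appears.
\<close>

lemma truncated_radial_derivative:
  fixes P :: "'a::euclidean_space \<Rightarrow> real"
  assumes P: "continuous_on UNIV P" "\<And>x. 0 \<le> P x" "\<And>x. x \<notin> ball 0 R \<Longrightarrow> P x = 0"
    and H: "\<And>x. 0 < P x \<Longrightarrow> GDERIV P x :> H x" "continuous_on {x. 0 < P x} H"
    and H0: "\<And>x. P x = 0 \<Longrightarrow> H x = 0"
    and [measurable]: "H \<in> borel_measurable borel"
    and \<epsilon>: "0 < \<epsilon>"
  shows "(\<integral>x. (1 - (1 - max 0 (P x - \<epsilon>) / P x)\<^sup>2) * (x \<bullet> H x) \<partial>lborel)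
    = - real DIM('a) * (\<integral>x. (max 0 (P x - \<epsilon>))\<^sup>2 / P x \<partial>lborel)"
proof -
  \<comment> \<open>The quotient rule for (u - \<epsilon>)^2 / u on u > \<epsilon> gives 2 \<tau> -
    \<tau>^2. The form 1 - (1 - \<tau>)^2 shows at once that this factor lies between 0 and
    1.\<close>
  let ?\<tau> = "\<lambda>x. max 0 (P x - \<epsilon>) / P x"
  let ?g = "\<lambda>x. (1 - (1 - ?\<tau> x)\<^sup>2) *\<^sub>R H x"
  let ?f = "\<lambda>x. (max 0 (P x - \<epsilon>))\<^sup>2 / P x"
  have [measurable]: "P \<in> borel_measurable borel"
    using P(1) by (rule borel_measurable_continuous_onI)
  have deriv: "GDERIV ?f x :> ?g x" for x
  proof (cases "0 < P x")
    case True
    have "((\<lambda>u. (max 0 (u - \<epsilon>))\<^sup>2) has_real_derivative 2 * max 0 (P x - \<epsilon>)) (at (P x))"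
    proof -
      have "((\<lambda>u. u - \<epsilon>) has_real_derivative 1) (at (P x))"
        by (auto intro!: derivative_eq_intros)
      from DERIV_chain2[OF has_real_derivative_max_zero_square this] show ?thesis by simp
    qed
    then have "((\<lambda>u. (max 0 (u - \<epsilon>))\<^sup>2 / u) has_real_derivative
        (2 * max 0 (P x - \<epsilon>) * P x - (max 0 (P x - \<epsilon>))\<^sup>2 * 1) / (P x * P x)) (at (P x))"
      using True by (intro DERIV_divide) auto
    moreover have "(2 * max 0 (P x - \<epsilon>) * P x - (max 0 (P x - \<epsilon>))\<^sup>2 * 1) / (P x * P x) = 1 - (1 - ?\<tau> x)\<^sup>2"
      using True by (simp add: field_simps power2_eq_square)
    ultimately show ?thesis
      using GDERIV_DERIV_compose[OF H(1)[OF True], of "\<lambda>u. (max 0 (u - \<epsilon>))\<^sup>2 / u" "1 - (1 - ?\<tau> x)\<^sup>2"]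
      by simp
  next
    case False
    then have x: "P x = 0" using P(2)[of x] by simp
    \<comment> \<open>The truncated function vanishes on the whole neighbourhood where P <
      \<epsilon>, so it is differentiable at zeros of P without any assumption on P there.\<close>
    have op: "open {x. P x < \<epsilon>}"
      using P(1) by (intro open_Collect_less) auto
    have "((\<lambda>x. 0::real) has_derivative (\<lambda>h. h \<bullet> ?g x)) (at x)"
      using H0[OF x] by simp
    then show ?thesis
      unfolding gderiv_def by (rule has_derivative_transform_within_open[OF _ op]) (use x \<epsilon> in auto)
  qed
  \<comment> \<open>The factor is 0 outside \<open>S\<close>, while \<open>S\<close> is a compact
    subset of the region where \<open>H\<close> is continuous. Hence \<open>?g\<close> is globally
    bounded even if \<open>H\<close> is unbounded near the zero set of P.\<close>
  define S where "S = {x. \<epsilon> \<le> P x}"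
  have "closed S" unfolding S_def using P(1) by (intro closed_Collect_le) auto
  moreover have "S \<subseteq> ball 0 R" using P(3) \<epsilon> unfolding S_def by force
  ultimately have "compact S"
    using bounded_subset[OF bounded_ball] by (auto simp: compact_eq_bounded_closed)
  moreover have "continuous_on S H"
    using H(2) by (rule continuous_on_subset) (use \<epsilon> in \<open>auto simp: S_def\<close>)
  ultimately have "bounded (H ` S)"
    by (intro compact_imp_bounded compact_continuous_image)
  then obtain B where B: "\<And>x. x \<in> S \<Longrightarrow> norm (H x) \<le> B" "0 < B"
    by (auto simp: bounded_pos)
  have bound: "norm (?g x) \<le> B" for x
  proof (cases "x \<in> S")
    case True
    then have "0 \<le> ?\<tau> x" "?\<tau> x \<le> 1" using \<epsilon> by (auto simp: S_def divide_le_eq_1)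
    then have "0 \<le> 1 - ?\<tau> x" "1 - ?\<tau> x \<le> 1" by auto
    then have "(1 - ?\<tau> x)\<^sup>2 \<le> 1" by (simp add: power_le_one)
    then have "\<bar>1 - (1 - ?\<tau> x)\<^sup>2\<bar> * norm (H x) \<le> 1 * B"
      using B(1)[OF True] by (intro mult_mono) auto
    then show ?thesis by simp
  next
    case False
    then show ?thesis using B(2) by (simp add: S_def)
  qed
  have "(\<integral>x. x \<bullet> ?g x \<partial>lborel) = - real DIM('a) * (\<integral>x. ?f x \<partial>lborel)"
    by (rule integral_radial_derivative[OF deriv bound, where R = R]) (use P(3) in auto)
  then show ?thesis by simp
qed

text \<open>Let \<epsilon> tend to 0 in the truncated identity. Both weights lie in [0,1] and tend
  to 1 where P > 0, while both integrands vanish where P = 0; |x . H| and P dominate.\<close>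

lemma integral_radial_derivative_pos:
  fixes P :: "'a::euclidean_space \<Rightarrow> real"
  assumes P: "continuous_on UNIV P" "\<And>x. 0 \<le> P x" "\<And>x. x \<notin> ball 0 R \<Longrightarrow> P x = 0"
    and H: "\<And>x. 0 < P x \<Longrightarrow> GDERIV P x :> H x" "continuous_on {x. 0 < P x} H"
    and H0: "\<And>x. P x = 0 \<Longrightarrow> H x = 0"
    and Hm[measurable]: "H \<in> borel_measurable borel"
    and int: "integrable lborel (\<lambda>x. x \<bullet> H x)" "integrable lborel P"
  shows "(\<integral>x. x \<bullet> H x \<partial>lborel) = - real DIM('a) * (\<integral>x. P x \<partial>lborel)"
proof -
  define \<epsilon> where "\<epsilon> = (\<lambda>n. inverse (real (Suc n)))"
  have \<epsilon>: "0 < \<epsilon> n" for n by (simp add: \<epsilon>_def)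
  have \<epsilon>0: "\<epsilon> \<longlonglongrightarrow> 0" unfolding \<epsilon>_def by (rule LIMSEQ_inverse_real_of_nat)
  have [measurable]: "P \<in> borel_measurable borel"
    using P(1) by (rule borel_measurable_continuous_onI)
  let ?\<tau> = "\<lambda>n x. max 0 (P x - \<epsilon> n) / P x"
  have \<tau>: "0 \<le> ?\<tau> n x" "?\<tau> n x \<le> 1" for n x
    using P(2)[of x] \<epsilon>[of n] by (auto simp: divide_le_eq_1)
  have lim: "(\<lambda>n. ?\<tau> n x) \<longlonglongrightarrow> 1" if "0 < P x" for x
  proof -
    have "(\<lambda>n. ?\<tau> n x) \<longlonglongrightarrow> max 0 (P x - 0) / P x"
      using that by (intro tendsto_intros \<epsilon>0) auto
    then show ?thesis using that by simp
  qed
  have "(\<lambda>n. \<integral>x. (1 - (1 - ?\<tau> n x)\<^sup>2) * (x \<bullet> H x) \<partial>lborel) \<longlonglongrightarrow> (\<integral>x. x \<bullet> H x \<partial>lborel)"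
  proof (rule integral_dominated_convergence[where w = "\<lambda>x. \<bar>x \<bullet> H x\<bar>"])
    show "AE x in lborel. (\<lambda>n. (1 - (1 - ?\<tau> n x)\<^sup>2) * (x \<bullet> H x)) \<longlonglongrightarrow> x \<bullet> H x"
    proof (rule AE_I2)
      fix x
      show "(\<lambda>n. (1 - (1 - ?\<tau> n x)\<^sup>2) * (x \<bullet> H x)) \<longlonglongrightarrow> x \<bullet> H x"
      proof (cases "P x = 0")
        case True
        then show ?thesis by (simp add: H0)
      next
        case False
        then have "0 < P x" using P(2)[of x] by linarith
        then have "(\<lambda>n. (1 - (1 - ?\<tau> n x)\<^sup>2) * (x \<bullet> H x)) \<longlonglongrightarrow> (1 - (1 - 1)\<^sup>2) * (x \<bullet> H x)"
          by (intro tendsto_intros lim)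
        then show ?thesis by simp
      qed
    qed
    show "AE x in lborel. norm ((1 - (1 - ?\<tau> n x)\<^sup>2) * (x \<bullet> H x)) \<le> \<bar>x \<bullet> H x\<bar>" for n
    proof (rule AE_I2)
      fix x
      have "0 \<le> 1 - ?\<tau> n x" "1 - ?\<tau> n x \<le> 1" using \<tau>[of x n] by auto
      then have "(1 - ?\<tau> n x)\<^sup>2 \<le> 1" by (simp add: power_le_one)
      then have "\<bar>1 - (1 - ?\<tau> n x)\<^sup>2\<bar> * \<bar>x \<bullet> H x\<bar> \<le> 1 * \<bar>x \<bullet> H x\<bar>"
        by (intro mult_right_mono) auto
      then show "norm ((1 - (1 - ?\<tau> n x)\<^sup>2) * (x \<bullet> H x)) \<le> \<bar>x \<bullet> H x\<bar>"
        by (simp add: abs_mult)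
    qed
  qed (use int in auto)
  moreover have "(\<lambda>n. - real DIM('a) * (\<integral>x. (max 0 (P x - \<epsilon> n))\<^sup>2 / P x \<partial>lborel))
      \<longlonglongrightarrow> - real DIM('a) * (\<integral>x. P x \<partial>lborel)"
  proof (intro tendsto_mult tendsto_const, rule integral_dominated_convergence[where w = P])
    have eq: "(max 0 (P x - \<epsilon> n))\<^sup>2 / P x = P x * (?\<tau> n x)\<^sup>2" for n x
      by (cases "P x = 0") (auto simp: power_divide power2_eq_square)
    show "AE x in lborel. (\<lambda>n. (max 0 (P x - \<epsilon> n))\<^sup>2 / P x) \<longlonglongrightarrow> P x"
    proof (rule AE_I2)
      fix x
      show "(\<lambda>n. (max 0 (P x - \<epsilon> n))\<^sup>2 / P x) \<longlonglongrightarrow> P x"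
      proof (cases "P x = 0")
        case False
        then have "0 < P x" using P(2)[of x] by linarith
        then have "(\<lambda>n. P x * (?\<tau> n x)\<^sup>2) \<longlonglongrightarrow> P x * 1\<^sup>2"
          by (intro tendsto_intros lim)
        then show ?thesis by (simp add: eq)
      qed simp
    qed
    show "AE x in lborel. norm ((max 0 (P x - \<epsilon> n))\<^sup>2 / P x) \<le> P x" for n
    proof (rule AE_I2)
      fix x
      have "(?\<tau> n x)\<^sup>2 \<le> 1" using \<tau>[of x n] by (simp add: power_le_one)
      then have "P x * (?\<tau> n x)\<^sup>2 \<le> P x * 1" using P(2)[of x] by (intro mult_left_mono) auto
      then show "norm ((max 0 (P x - \<epsilon> n))\<^sup>2 / P x) \<le> P x"
        using P(2)[of x] by (simp add: eq)
    qed
  qed (use int in auto)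
  ultimately show ?thesis
    using truncated_radial_derivative[OF P H H0 Hm \<epsilon>] by (auto intro: LIMSEQ_unique)
qed

section \<open>Internal energy for the exponent 4/3\<close>

text \<open>The integrand p(s) / s^2 is k s^(-2/3), with integral 3 k t^(1/3). The factor 3 = 1 /
  (4/3 - 1) equals the space dimension, which is why the internal energy matches the pressure term
  of the virial identity.\<close>

lemma internal_energy_polytropic:
  assumes "0 \<le> t"
  shows "internal_energy (\<lambda>s. k * s powr (4/3)) t = 3 * k * t powr (4/3)"
proof (cases "t = 0")
  case False
  with assms have t: "0 < t" by simp
  \<comment> \<open>At s = 0 both sides are 0 by the conventions for division by 0 and for
    \<open>powr\<close> with base 0.\<close>
  have eq: "k * s powr (4/3) / s\<^sup>2 = k * s powr (-2/3)" if "s \<in> {0..t}" for s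
  proof (cases "s = 0")
    case False
    then have "0 < s" using that by simp
    then show ?thesis by (simp add: powr_diff[of s "4/3" 2, simplified])
  qed simp
  have I: "((\<lambda>s. s powr (-2/3)) has_integral 3 * t powr (1/3)) {0..t}"
    using has_integral_powr_from_0[of "-2/3" t] t by (simp add: mult.commute)
  then have "(\<lambda>s. s powr (-2/3)) absolutely_integrable_on {0..t}"
    by (intro nonnegative_absolutely_integrable_1) (auto simp: integrable_on_def)
  then have "(LINT s:{0..t}|lebesgue. s powr (-2/3)) = 3 * t powr (1/3)"
    using I by (simp add: set_lebesgue_integral_eq_integral integral_unique)
  moreover have "(LINT s:{0..t}|lebesgue. k * s powr (4/3) / s\<^sup>2) = (LINT s:{0..t}|lebesgue. k * s powr (-2/3))"
    by (rule set_lebesgue_integral_cong) (use eq in auto)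
  ultimately have "internal_energy (\<lambda>s. k * s powr (4/3)) t = t * (k * (3 * t powr (1/3)))"
    by (simp add: internal_energy_def)
  also have "\<dots> = 3 * k * (t powr 1 * t powr (1/3))" using t by simp
  also have "\<dots> = 3 * k * t powr (4/3)" unfolding powr_add[symmetric] by simp
  finally show ?thesis .
qed (simp add: internal_energy_def)

section \<open>Distance to the axis and pointwise facts\<close>

lemma continuous_on_axis_dist: "continuous_on UNIV axis_dist"
  unfolding axis_dist_def by (intro continuous_intros)

lemma axis_dist_nonneg: "0 \<le> axis_dist x"
  by (simp add: axis_dist_def)

lemma axis_dist_le_norm: "axis_dist x \<le> norm x"
proof -
  have "(norm x)\<^sup>2 = (x$1)\<^sup>2 + (x$2)\<^sup>2 + (x$3)\<^sup>2"
    by (simp add: norm_vec_def L2_set_def sum_3 sum_nonneg)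
  then show ?thesis unfolding axis_dist_def by (intro real_le_lsqrt) auto
qed

text \<open>For s > 0 every ray from the origin meets the cylinder surface at most once; for s \<le>
  0 the set lies in the plane x1 = 0. The case s = 0 discards the axis, and general s gives
  continuity of the cylinder mass.\<close>

lemma AE_axis_dist_neq: "AE x in lborel. axis_dist x \<noteq> s"
proof -
  have "negligible {x. axis_dist x = s}"
  proof (cases "0 < s")
    case True
    show ?thesis
    proof (rule starlike_negligible[where a = 0])
      show "closed {x. axis_dist x = s}"
        by (intro closed_Collect_eq continuous_on_axis_dist continuous_intros)
      fix c and x :: "real^3"
      assume "0 \<le> c" and cx: "0 + c *\<^sub>R x \<in> {x. axis_dist x = s}" and x: "0 + x \<in> {x. axis_dist x = s}"
      have "axis_dist (c *\<^sub>R x) = c * axis_dist x"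
        using \<open>0 \<le> c\<close> by (simp add: axis_dist_def power_mult_distrib real_sqrt_mult flip: distrib_left)
      then show "c = 1" using cx x True by simp
    qed
  next
    case False
    have "{x. axis_dist x = s} \<subseteq> {x. x$1 = 0}"
    proof
      fix x :: "real^3" assume "x \<in> {x. axis_dist x = s}"
      then have "axis_dist x = 0" using False axis_dist_nonneg[of x] by simp
      then show "x \<in> {x. x$1 = 0}" by (simp add: axis_dist_def)
    qed
    then show ?thesis
      using negligible_subset[OF negligible_standard_hyperplane_cart] by blast
  qed
  then have "AE x in lebesgue. axis_dist x \<noteq> s"
    by (intro AE_I'[of "{x. axis_dist x = s}"]) (auto simp: negligible_iff_null_sets)
  then show ?thesis by (simp add: AE_completion_iff)
qed

text \<open>The set where f < 0 is open and null, hence empty.\<close>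

lemma AE_nonneg_continuous:
  fixes f :: "'a::euclidean_space \<Rightarrow> real"
  assumes "continuous_on UNIV f" "AE x in lebesgue. 0 \<le> f x"
  shows "0 \<le> f x"
proof -
  have "{x. f x < 0} \<in> null_sets lebesgue"
    using assms(2) borel_measurable_continuous_onI[OF assms(1)]
    by (subst (asm) AE_iff_null) (auto simp: not_le)
  then have "negligible {x. f x < 0}" by (simp add: negligible_iff_null_sets)
  moreover have "open {x. f x < 0}" using assms(1) by (intro open_Collect_less) auto
  ultimately have "{x. f x < 0} = {}" using open_not_negligible by blast
  then show ?thesis by (auto simp: not_less)
qed

lemma GDERIV_unique:
  assumes "GDERIV f x :> a" "GDERIV f x :> b"
  shows "a = b"
proof -
  have "(\<lambda>h. h \<bullet> a) = (\<lambda>h. h \<bullet> b)"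
    using assms unfolding gderiv_def by (rule has_derivative_unique)
  then show ?thesis by (metis vector_eq_ldot)
qed

text \<open>On the axis, division by 0 turns \<open>radial_unit x\<close> into the zero vector, so
  the identity persists there.\<close>

lemma inner_radial_unit: "x \<bullet> radial_unit x = axis_dist x"
proof (cases "axis_dist x = 0")
  case True
  then show ?thesis by (simp add: radial_unit_def inner_vec_def sum_3)
next
  case False
  have "x \<bullet> radial_unit x = ((x$1)\<^sup>2 + (x$2)\<^sup>2) / axis_dist x"
    by (simp add: radial_unit_def inner_vec_def sum_3 add_divide_distrib power2_eq_square)
  also have "\<dots> = (axis_dist x)\<^sup>2 / axis_dist x" by (simp add: axis_dist_def)
  finally show ?thesis using False by (simp add: power2_eq_square)
qed

section \<open>Cylinder mass and rotational energy of a bounded density with bounded support\<close>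

context
  fixes \<rho> :: "real^3 \<Rightarrow> real" and K R :: real
  assumes \<rho>m[measurable]: "\<rho> \<in> borel_measurable borel"
    and \<rho>0: "\<And>x. 0 \<le> \<rho> x" and \<rho>K: "\<And>x. \<rho> x \<le> K * indicator (ball 0 R) x"
begin

lemma integrable_density: "integrable lborel \<rho>"
  using integrable_mult_bounded_support[of \<rho> K R "\<lambda>_. 1"] \<rho>m \<rho>0 \<rho>K by auto

lemma axis_dist_measurable [measurable]: "axis_dist \<in> borel_measurable borel"
  using continuous_on_axis_dist by (rule borel_measurable_continuous_onI)

lemma cylinder_mass_lborel: "cylinder_mass \<rho> s = (\<integral>x. indicator {x. axis_dist x < s} x * \<rho> x \<partial>lborel)"
  unfolding cylinder_mass_def set_lebesgue_integral_def
  by (subst integral_completion) auto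

lemma integrable_cylinder_density: "integrable lborel (\<lambda>x. indicator {x. axis_dist x < s} x * \<rho> x)"
  by (rule Bochner_Integration.integrable_bound[OF integrable_density]) (auto simp: indicator_def)

lemma cylinder_mass_mono: "s \<le> t \<Longrightarrow> cylinder_mass \<rho> s \<le> cylinder_mass \<rho> t"
  unfolding cylinder_mass_lborel
  by (intro integral_mono integrable_cylinder_density) (auto simp: indicator_def \<rho>0)

lemma cylinder_mass_0: "cylinder_mass \<rho> 0 = 0"
  unfolding cylinder_mass_lborel by (simp add: not_less axis_dist_nonneg)

lemma cylinder_mass_nonneg: "0 \<le> cylinder_mass \<rho> s"
  unfolding cylinder_mass_lborel by (intro integral_nonneg_AE) (simp add: \<rho>0)

lemma cylinder_mass_le: "cylinder_mass \<rho> s \<le> (\<integral>x. \<rho> x \<partial>lborel)"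
  unfolding cylinder_mass_lborel
  by (intro integral_mono integrable_cylinder_density integrable_density) (auto simp: indicator_def \<rho>0)

lemma cylinder_mass_total: "cylinder_mass \<rho> R = (\<integral>x. \<rho> x \<partial>lborel)"
  unfolding cylinder_mass_lborel
proof (rule Bochner_Integration.integral_cong)
  fix x :: "real^3"
  show "indicator {x. axis_dist x < R} x * \<rho> x = \<rho> x"
    using \<rho>0[of x] \<rho>K[of x] axis_dist_le_norm[of x] by (cases "x \<in> ball 0 R") auto
qed simp

text \<open>The indicators converge off the cylinder surface of radius s, which is a null set, and
  rho dominates.\<close>

lemma continuous_on_cylinder_mass: "continuous_on UNIV (cylinder_mass \<rho>)"
proof -
  have "(\<lambda>n. cylinder_mass \<rho> (X n)) \<longlonglongrightarrow> cylinder_mass \<rho> s" if X: "X \<longlonglongrightarrow> s" for X :: "nat \<Rightarrow> real" and s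
    unfolding cylinder_mass_lborel
  proof (rule integral_dominated_convergence[where w = \<rho>])
    show "AE x in lborel. (\<lambda>n. indicator {x. axis_dist x < X n} x * \<rho> x) \<longlonglongrightarrow> indicator {x. axis_dist x < s} x * \<rho> x"
      using AE_axis_dist_neq[of s]
    proof eventually_elim
      case (elim x)
      then have "\<forall>\<^sub>F n in sequentially. (axis_dist x < X n) = (axis_dist x < s)"
        using order_tendstoD[OF X, of "axis_dist x"]
        by (cases "axis_dist x < s") (auto elim!: eventually_mono)
      then have "\<forall>\<^sub>F n in sequentially. indicator {x. axis_dist x < X n} x * \<rho> x = indicator {x. axis_dist x < s} x * \<rho> x"
        by eventually_elim (simp add: indicator_def)
      then show ?case by (rule tendsto_eventually)
    qed
  qed (use integrable_density \<rho>0 in \<open>auto simp: indicator_def\<close>)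
  then show ?thesis
    by (auto simp: continuous_on_eq_continuous_at continuous_at_sequentially comp_def)
qed

text \<open>If the integral were 0, then J = 0 almost everywhere. By continuity L > 0 on some
  [m0, m1], and the cylinder mass attains both end points, at radii s1 and s2. Then rho = 0 almost
  everywhere in the shell s1 \<le> r < s2, so the masses at s1 and s2 agree, against m0 <
  m1.\<close>

lemma rotational_energy_pos:
  fixes L :: "real \<Rightarrow> real"
  defines "J \<equiv> \<lambda>x. \<rho> x * L (cylinder_mass \<rho> (axis_dist x)) / (axis_dist x)\<^sup>2"
  assumes L: "continuous_on {0..\<integral>x. \<rho> x \<partial>lborel} L"
    and L0: "\<And>m. 0 \<le> m \<Longrightarrow> m \<le> (\<integral>x. \<rho> x \<partial>lborel) \<Longrightarrow> 0 \<le> L m"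
    and m0: "0 < m0" "m0 < (\<integral>x. \<rho> x \<partial>lborel)" "0 < L m0"
    and int: "integrable lborel J"
  shows "0 < (\<integral>x. J x \<partial>lborel)"
proof (rule ccontr)
  let ?m = "cylinder_mass \<rho>" and ?M = "\<integral>x. \<rho> x \<partial>lborel"
  assume neg: "\<not> 0 < (\<integral>x. J x \<partial>lborel)"
  have J0: "0 \<le> J x" for x
    unfolding J_def by (intro divide_nonneg_nonneg mult_nonneg_nonneg \<rho>0 L0 cylinder_mass_nonneg cylinder_mass_le) auto
  have "0 \<le> (\<integral>x. J x \<partial>lborel)"
    by (rule integral_nonneg_AE) (simp add: J0)
  then have "(\<integral>x. J x \<partial>lborel) = 0"
    using neg by simp
  then have J: "AE x in lborel. J x = 0"
    using integral_nonneg_eq_0_iff_AE[OF int] J0 by simp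
  have "isCont L m0"
    using m0 by (intro continuous_on_interior[OF L]) (simp add: interior_atLeastAtMost_real)
  then have "\<forall>\<^sub>F m in at m0. 0 < L m"
    using m0(3) unfolding isCont_def by (rule order_tendstoD)
  then obtain d where d: "0 < d" "\<And>m. m \<noteq> m0 \<Longrightarrow> dist m m0 < d \<Longrightarrow> 0 < L m"
    unfolding eventually_at by auto
  \<comment> \<open>Half of \<open>d\<close> keeps \<open>m1\<close> strictly inside the
    neighbourhood where L > 0, and the cap \<open>?M - m0\<close> keeps it within the range of the
    cylinder mass.\<close>
  define m1 where "m1 = m0 + min (d / 2) (?M - m0)"
  have m1: "m0 < m1" "m1 \<le> ?M" using d(1) m0 by (auto simp: m1_def)
  have Lpos: "0 < L m" if "m0 \<le> m" "m \<le> m1" for m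
    using d(2)[of m] m0(3) that d(1) by (cases "m = m0") (auto simp: m1_def dist_real_def)
  have R: "0 \<le> R"
    using cylinder_mass_mono[of R 0] cylinder_mass_total cylinder_mass_0 m0 by (cases "0 \<le> R") auto
  have ivt: "\<exists>s. ?m s = y" if "0 \<le> y" "y \<le> ?M" for y
    using IVT'[of ?m 0 y R] that R continuous_on_subset[OF continuous_on_cylinder_mass]
    by (auto simp: cylinder_mass_0 cylinder_mass_total)
  obtain s1 where s1: "?m s1 = m0" using ivt[of m0] m0 by auto
  obtain s2 where s2: "?m s2 = m1" using ivt[of m1] m0 m1 by auto
  have "s1 \<le> s2" using cylinder_mass_mono[of s2 s1] s1 s2 m1 by (cases "s1 \<le> s2") auto
  \<comment> \<open>Since r \<ge> s1 > 0 in the shell, J = 0 there really forces rho = 0 and does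
    not come from division by 0.\<close>
  have "0 < s1" using cylinder_mass_mono[of s1 0] s1 cylinder_mass_0 m0 by (cases "0 < s1") auto
  have "AE x in lborel. indicator {x. axis_dist x < s1} x * \<rho> x = indicator {x. axis_dist x < s2} x * \<rho> x"
    using J
  proof eventually_elim
    case (elim x)
    show ?case
    proof (cases "s1 \<le> axis_dist x \<and> axis_dist x < s2")
      case True
      then have "m0 \<le> ?m (axis_dist x)" "?m (axis_dist x) \<le> m1"
        using cylinder_mass_mono[of s1 "axis_dist x"] cylinder_mass_mono[of "axis_dist x" s2] s1 s2 by auto
      then have "0 < L (?m (axis_dist x))" by (rule Lpos)
      then have "\<rho> x = 0" using elim True \<open>0 < s1\<close> by (auto simp: J_def)
      then show ?thesis by simp
    next
      case False
      then show ?thesis using \<open>s1 \<le> s2\<close> by (auto simp: indicator_def)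
    qed
  qed
  then have "?m s1 = ?m s2"
    unfolding cylinder_mass_lborel by (intro integral_cong_AE) auto
  then show False using s1 s2 m1 by simp
qed

end

theorem theorem4p4:
  fixes M k :: real and L :: "real \<Rightarrow> real" and p :: "real \<Rightarrow> real"
    and G :: "(real^3) set" and \<rho>h :: "real^3 \<Rightarrow> real" and m0 :: real
  assumes "M > 0" and "k > 0"
    and "p = (\<lambda>t. k * t powr (4/3))"
    and "C1_on_interval 0 M L"
    and "L 0 = 0"
    and "\<And>m. 0 \<le> m \<Longrightarrow> m \<le> M \<Longrightarrow> L m \<ge> 0"
    and "0 < m0" and "m0 < M" and "L m0 > 0"
    and "open G" and "bounded G" and "lipschitz_boundary G"
    and "\<rho>h \<in> admissible p L M"
    and "C1_on_open G \<rho>h" and "continuous_on UNIV \<rho>h"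
    and "steady_rotating_solution p L G \<rho>h"
  shows "(INF \<rho>\<in>admissible p L M. ereal (energy p L \<rho>)) < 0"
proof -

  \<comment> \<open>Bounds and integrability for the steady state\<close>
  define U where "U = newton_potential \<rho>h"
  define P where "P = (\<lambda>x. k * \<rho>h x powr (4/3))"
  define J where "J = (\<lambda>x. \<rho>h x * L (cylinder_mass \<rho>h (axis_dist x)) / (axis_dist x)\<^sup>2)"
  note adm = assms(13)[unfolded admissible_def mem_Collect_eq]
  have nonneg: "0 \<le> \<rho>h x" for x
    using AE_nonneg_continuous[OF assms(15)] adm by blast
  have zero: "\<rho>h x = 0" if "x \<notin> G" for x
    using assms(16) that unfolding steady_rotating_solution_def by blast
  have \<rho>m[measurable]: "\<rho>h \<in> borel_measurable borel"
    using assms(15) by (rule borel_measurable_continuous_onI)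
  obtain R where R: "G \<subseteq> ball 0 R"
    using assms(11) bounded_subset_ballD by blast
  have out: "\<rho>h x = 0" if "x \<notin> ball 0 R" for x
    using zero R that by blast
  have "compact (\<rho>h ` cball 0 R)"
    using assms(15) by (intro compact_continuous_image) (auto intro: continuous_on_subset)
  then obtain K where K: "0 < K" "\<And>x. x \<in> cball 0 R \<Longrightarrow> \<bar>\<rho>h x\<bar> \<le> K"
    using compact_imp_bounded[of "\<rho>h ` cball 0 R"] unfolding bounded_pos by auto
  have bnd: "\<bar>\<rho>h x\<bar> \<le> K * indicator (ball 0 R) x" for x
    using K(2)[of x] out[of x] by (cases "x \<in> ball 0 R") auto
  then have bnd': "\<rho>h x \<le> K * indicator (ball 0 R) x" for x
    using abs_ge_self order_trans by blast
  note basic = \<rho>m nonneg bnd'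
  have mass: "(\<integral>x. \<rho>h x \<partial>lborel) = M"
    using adm by (simp add: integral_completion)
  obtain C where C: "C-lipschitz_on UNIV U"
    using newton_potential_lipschitz[OF \<rho>m bnd] K(1) unfolding U_def by force
  have intV: "integrable lborel (\<lambda>x. \<rho>h x * U x)"
    by (rule integrable_mult_bounded_support[OF \<rho>m bnd lipschitz_on_continuous_on[OF C]])
  have cont_powr: "continuous_on UNIV (\<lambda>x. \<rho>h x powr a)" if "0 < a" for a
    using nonneg that by (intro continuous_on_powr' assms(15)) auto
  have contP: "continuous_on UNIV P"
    unfolding P_def by (intro continuous_on_mult_left cont_powr) simp
  have intP: "integrable lborel P"
  proof -
    \<comment> \<open>Splitting P as rho times k rho^(1/3) brings it into the form of a bounded
      compactly supported density times a continuous function.\<close>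
    have "continuous_on UNIV (\<lambda>x. k * \<rho>h x powr (1/3))"
      by (intro continuous_on_mult_left cont_powr) simp
    then have "integrable lborel (\<lambda>x. \<rho>h x * (k * \<rho>h x powr (1/3)))"
      by (rule integrable_mult_bounded_support[OF \<rho>m bnd])
    moreover have "\<rho>h x * (k * \<rho>h x powr (1/3)) = P x" for x
    proof -
      have "\<rho>h x * \<rho>h x powr (1/3) = \<rho>h x powr 1 * \<rho>h x powr (1/3)"
        using nonneg[of x] by simp
      also have "\<dots> = \<rho>h x powr (4/3)" unfolding powr_add[symmetric] by simp
      finally show ?thesis by (simp add: P_def mult.left_commute)
    qed
    ultimately show ?thesis by simp
  qed
  have A: "internal_energy p (\<rho>h x) = 3 * P x" for x
    using internal_energy_polytropic[OF nonneg] by (simp add: assms(3) P_def)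

  \<comment> \<open>The rotational term\<close>
  have contL: "continuous_on {0..M} L"
    using assms(4) unfolding C1_on_interval_def by (blast intro: DERIV_continuous_on)
  have contLm: "continuous_on UNIV (\<lambda>x. L (cylinder_mass \<rho>h (axis_dist x)))"
  proof (rule continuous_on_compose2[OF contL])
    show "continuous_on UNIV (\<lambda>x. cylinder_mass \<rho>h (axis_dist x))"
      by (rule continuous_on_compose2[OF continuous_on_cylinder_mass[OF basic] continuous_on_axis_dist]) auto
    show "(\<lambda>x. cylinder_mass \<rho>h (axis_dist x)) ` UNIV \<subseteq> {0..M}"
      using cylinder_mass_nonneg[OF basic] cylinder_mass_le[OF basic] mass by auto
  qed
  have Lm: "(\<lambda>x. L (cylinder_mass \<rho>h (axis_dist x))) \<in> borel_measurable borel"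
    using contLm by (rule borel_measurable_continuous_onI)
  have axis: "axis_dist \<in> borel_measurable borel"
    using continuous_on_axis_dist by (rule borel_measurable_continuous_onI)
  have [measurable]: "U \<in> borel_measurable borel"
    using lipschitz_on_continuous_on[OF C] by (rule borel_measurable_continuous_onI)
  have [measurable]: "P \<in> borel_measurable borel"
    using contP by (rule borel_measurable_continuous_onI)
  have [measurable]: "J \<in> borel_measurable borel"
    unfolding J_def
    by (intro borel_measurable_divide borel_measurable_times borel_measurable_power Lm axis \<rho>m)
  \<comment> \<open>The factor r^(-2) is singular on the axis. Integrability of \<open>J\<close> is
    read off from admissibility by subtracting the internal and potential terms from the integrable
    sum.\<close>
  have intJ: "integrable lborel J"
  proof -
    have "integrable lebesgue (\<lambda>x. 3 * P x + J x + \<rho>h x * U x)"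
      using adm by (simp add: A J_def U_def)
    then have "integrable lborel (\<lambda>x. 3 * P x + J x + \<rho>h x * U x)"
      by (subst (asm) integrable_completion) auto
    from Bochner_Integration.integrable_diff[OF Bochner_Integration.integrable_diff[OF this intV] integrable_mult_right[OF intP, of 3]]
    show ?thesis by simp
  qed
  have Jpos: "0 < (\<integral>x. J x \<partial>lborel)"
    unfolding J_def
    by (rule rotational_energy_pos[OF basic]) (use contL assms(6-9) intJ mass in \<open>auto simp: J_def\<close>)

  \<comment> \<open>The gradient of the pressure\<close>
  obtain g where g: "continuous_on G g" "\<And>x. x \<in> G \<Longrightarrow> GDERIV \<rho>h x :> g x"
    using assms(14) unfolding C1_on_open_def by blast
  \<comment> \<open>The chain rule gradient of P, cut off outside G to be Borel on the whole space.
    The positive power 1/3 makes it vanish at zeros of the density inside G as well.\<close>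
  define H where "H = (\<lambda>x. indicator G x *\<^sub>R ((k * (4/3) * \<rho>h x powr (1/3)) *\<^sub>R g x))"
  have contH: "continuous_on G (\<lambda>x. (k * (4/3) * \<rho>h x powr (1/3)) *\<^sub>R g x)"
    by (intro continuous_on_scaleR continuous_on_mult_left g(1) continuous_on_subset[OF cont_powr]) auto
  have [measurable]: "H \<in> borel_measurable borel"
    unfolding H_def using assms(10) by (intro borel_measurable_continuous_on_indicator contH) auto
  have P0: "0 \<le> P x" for x using assms(2) by (simp add: P_def)
  have Ppos: "0 < P x \<longleftrightarrow> \<rho>h x \<noteq> 0" for x
    using assms(2) nonneg[of x] by (auto simp: P_def)
  have PG: "x \<in> G" if "\<rho>h x \<noteq> 0" for x using that zero by blast
  have derivP: "GDERIV P x :> H x" if "0 < P x" for x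
  proof -
    have x: "x \<in> G" "0 < \<rho>h x" using that PG[of x] Ppos[of x] nonneg[of x] by auto
    have "((\<lambda>t. k * t powr (4/3)) has_real_derivative k * (4/3) * \<rho>h x powr (1/3)) (at (\<rho>h x))"
      using x(2) by (auto intro!: derivative_eq_intros simp: powr_diff)
    from GDERIV_DERIV_compose[OF g(2)[OF x(1)] this] show ?thesis
      using x(1) by (simp add: P_def H_def)
  qed
  have H0: "H x = 0" if "P x = 0" for x
    using that assms(2) by (simp add: P_def H_def)
  have contH': "continuous_on {x. 0 < P x} H"
  proof -
    have "continuous_on {x. 0 < P x} (\<lambda>x. (k * (4/3) * \<rho>h x powr (1/3)) *\<^sub>R g x)"
      using contH by (rule continuous_on_subset) (use PG Ppos in blast)
    then show ?thesis
      by (rule continuous_on_eq) (use PG Ppos in \<open>auto simp: H_def\<close>)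
  qed

  \<comment> \<open>The gradient of the potential from the momentum equation\<close>
  \<comment> \<open>The momentum equation only asserts at each point that some gradient exists.
    Solving it for that gradient gives a closed formula whose weighted pairing with x is
    measurable.\<close>
  define gU where "gU = (\<lambda>x. (1 / \<rho>h x) *\<^sub>R (H x
    - (\<rho>h x * L (cylinder_mass \<rho>h (axis_dist x)) / axis_dist x ^ 3) *\<^sub>R radial_unit x))"
  have gU: "\<rho>h x * (x \<bullet> gU x) = x \<bullet> H x - J x" for x
  proof (cases "\<rho>h x = 0")
    case True
    then show ?thesis using H0[of x] by (simp add: J_def P_def)
  next
    case False
    have "c / axis_dist x ^ 3 * axis_dist x = c / (axis_dist x)\<^sup>2" for c
      by (simp add: power2_eq_square power3_eq_cube)
    then show ?thesis
      using False by (simp add: gU_def J_def inner_diff_right inner_radial_unit)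
  qed
  \<comment> \<open>The equation is available off the axis, a null set. There uniqueness of the
    gradient of P identifies \<open>gU x\<close> with the gradient of the potential.\<close>
  have derivU: "AE x in lborel. \<rho>h x \<noteq> 0 \<longrightarrow> GDERIV (newton_potential \<rho>h) x :> gU x"
    using AE_axis_dist_neq[of 0]
  proof eventually_elim
    case (elim x)
    show ?case
    proof
      assume x: "\<rho>h x \<noteq> 0"
      obtain h where h: "GDERIV (newton_potential \<rho>h) x :> h"
        "GDERIV P x :> \<rho>h x *\<^sub>R h
          + (\<rho>h x * L (cylinder_mass \<rho>h (axis_dist x)) / axis_dist x ^ 3) *\<^sub>R radial_unit x"
        using assms(16) PG[OF x] elim unfolding steady_rotating_solution_def assms(3) P_def by blast
      have "H x = \<rho>h x *\<^sub>R h
          + (\<rho>h x * L (cylinder_mass \<rho>h (axis_dist x)) / axis_dist x ^ 3) *\<^sub>R radial_unit x"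
        using derivP[of x] Ppos x by (intro GDERIV_unique[OF _ h(2)]) auto
      then have "gU x = h" using x by (simp add: gU_def)
      then show "GDERIV (newton_potential \<rho>h) x :> gU x" using h(1) by simp
    qed
  qed
  have meas: "(\<lambda>x. \<rho>h x * (x \<bullet> gU x)) \<in> borel_measurable borel"
    unfolding gU by measurable
  note vir = newton_potential_virial[OF \<rho>m bnd less_imp_le[OF K(1)] derivU meas, unfolded gU]
  \<comment> \<open>No bound on \<open>g\<close> near the boundary of G is at hand; integrability
    comes from the virial lemma, which covers x . H - J, after adding \<open>J\<close> back.\<close>
  have intH: "integrable lborel (\<lambda>x. x \<bullet> H x)"
    using Bochner_Integration.integrable_add[OF vir(1) intJ] by simp
  have "(\<integral>x. x \<bullet> H x \<partial>lborel) = - real DIM(real^3) * (\<integral>x. P x \<partial>lborel)"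
  proof (rule integral_radial_derivative_pos[OF contP P0 _ derivP contH' H0 _ intH intP])
    show "P x = 0" if "x \<notin> ball 0 R" for x
      using out[OF that] by (simp add: P_def)
  qed auto

  \<comment> \<open>The sign of the energy\<close>
  \<comment> \<open>The virial identity reads -3 int P - int J = -1/2 int rho U once the pressure
    integral is inserted.\<close>
  then have balance: "3 * (\<integral>x. P x \<partial>lborel) + (\<integral>x. J x \<partial>lborel) = (\<integral>x. \<rho>h x * U x \<partial>lborel) / 2"
    using vir(2) intH intJ by (simp add: U_def)
  have "energy p L \<rho>h = (LINT x|lebesgue. 3 * P x + 1/2 * J x - 1/2 * (\<rho>h x * U x))"
    by (simp add: energy_def A J_def U_def)
  also have "\<dots> = (\<integral>x. 3 * P x + 1/2 * J x - 1/2 * (\<rho>h x * U x) \<partial>lborel)"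
    by (rule integral_completion) auto
  also have "\<dots> = 3 * (\<integral>x. P x \<partial>lborel) + 1/2 * (\<integral>x. J x \<partial>lborel) - 1/2 * (\<integral>x. \<rho>h x * U x \<partial>lborel)"
    using intP intJ intV by simp
  \<comment> \<open>Eliminating int rho U by \<open>balance\<close> leaves exactly -1/2 int
    J.\<close>
  also have "\<dots> < 0" using balance Jpos by simp
  finally have "energy p L \<rho>h < 0" .
  then have "ereal (energy p L \<rho>h) < 0" by simp
  moreover have "(INF \<rho>\<in>admissible p L M. ereal (energy p L \<rho>)) \<le> ereal (energy p L \<rho>h)"
    by (rule INF_lower[OF assms(13)])
  ultimately show ?thesis by (rule le_less_trans[rotated])
qed

end
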